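(* Consider the MTLS problem with the data, standing assumptions and notation given in the context, assume that one of the genericity conditions (G1) or (G2) of the context holds, and let $x=x_{\rm M}$ be the MTLS solution. Put $r=Ax-b$, $P=A^TA-\tilde\sigma_{n_2+1}^2W$, $\bar\gamma=1+x^TWx$, $H_0=I_m-\frac{2rr^T}{\|r\|_2^2}$, $G(x)=[x^T,\,-1]\otimes I_m$ and $D=P^{-1}\big(A^T-\frac{2Wxr^T}{\bar\gamma}\big)$. Then the two formulae $$K_{\rm ZY}=\big[-(x^T\otimes D)-(r^T\otimes P^{-1})\Pi_{m,n},\ \ D\big]$$ and $$K=-P^{-1}\Big(A^TH_0\,G(x)+[\,I_n\otimes r^T,\ O_{n\times m}\,]\Big)$$ for the matrix of the first order perturbation estimate of the MTLS solution are equivalent, i.e. $K_{\rm ZY}=K$.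
   Context: Data and standing assumptions: $A\in\mathbb{R}^{m\times n}$, $m\ge n$, has full column rank, $b\in\mathbb{R}^m$, and $Ax=b$ is not consistent. $A=[A_1,A_2]$ with $A_1\in\mathbb{R}^{m\times n_1}$ (columns known exactly), $A_2\in\mathbb{R}^{m\times n_2}$, $n_1+n_2=n$; vectors $x=[x_1^T,x_2^T]^T$ are partitioned conformally. The MTLS problem is $\min_{E_2,f}\|[E_2,f]\|_F$ subject to $A_1x_1+(A_2+E_2)x_2=b+f$. An MTLS solution is a vector $x\in\mathbb{R}^n$ satisfying the constraint for some $(E_2,f)$ attaining the minimum over all triples $(E_2,f,x)$ satisfying the constraint; it is denoted $x_{\rm M}$ when unique. QR factorization: for an orthogonal $Q\in\mathbb{R}^{m\times m}$, $Q^T[A_1,A_2,b]=\begin{bmatrix}R_{11}&R_{12}&R_{1b}\\0&R_{22}&R_{2b}\end{bmatrix}$, upper triangular, with row blocks of sizes $n_1$, $m-n_1$ and column blocks of sizes $n_1,n_2,1$. Put $W=\mathrm{diag}(O_{n_1},I_{n_2})$, $\tilde W=\mathrm{diag}(W,1)$, $\tilde A=[A,b]$, and $\tilde\sigma_{n_2+1}=\sigma_{n_2+1}([R_{22},R_{2b}])$. Genericity conditions: (G1) $\sigma_{n_2}(R_{22})>\sigma_{n_2+1}([R_{22},R_{2b}])>0$; (G2) $\lambda_n(A^TA,W)>\lambda_{n+1}(\tilde A^T\tilde A,\tilde W)$. Here $\sigma_i$ is the $i$-th largest singular value (if $n_2=0$, read $\sigma_0=+\infty$), and $\lambda_i(M,N)$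 is the $i$-th largest generalized eigenvalue of the pair $(M,N)$, infinite eigenvalues (arising when $N$ is singular) being counted first. One has $\tilde\sigma_{n_2+1}^2=\lambda_{n+1}(\tilde A^T\tilde A,\tilde W)$, and under (G1) or (G2) the MTLS solution is unique and given by $x_{\rm M}=(A^TA-\tilde\sigma_{n_2+1}^2W)^{-1}A^Tb$. Notation: $\mathrm{vec}(\cdot)$ stacks the columns of a matrix; $\otimes$ is the Kronecker product, $A\otimes B=[a_{ij}B]$; $O_{p\times q}$ is the zero matrix; $\Pi_{m,n}$ is the vec-permutation matrix with $\mathrm{vec}(C^T)=\Pi_{m,n}\mathrm{vec}(C)$ for every $C\in\mathbb{R}^{m\times n}$. Both matrices are $n\times m(n+1)$ and act on $\mathrm{vec}([\Delta A,\Delta b])$ to give the first order change of the MTLS solution. *)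

theory Defs
  imports
    "Jordan_Normal_Form.DL_Rank"
    "Jordan_Normal_Form.Char_Poly"
    "Jordan_Normal_Form.Gauss_Jordan_Elimination"
    "HOL-Library.Extended_Real"
begin

definition mat_of_col :: "'a vec \<Rightarrow> 'a mat" where
  "mat_of_col v = transpose_mat (mat_of_row v)"

definition append_cols :: "'a :: zero mat \<Rightarrow> 'a mat \<Rightarrow> 'a mat" (infixr \<open>@\<^sub>c\<close> 65) where
  "A @\<^sub>c B = four_block_mat A B (0\<^sub>m 0 (dim_col A)) (0\<^sub>m 0 (dim_col B))"

definition kronecker_prod :: "'a :: times mat \<Rightarrow> 'a mat \<Rightarrow> 'a mat" (infixl \<open>\<otimes>\<^sub>k\<close> 70) where
  "A \<otimes>\<^sub>k B = mat (dim_row A * dim_row B) (dim_col A * dim_col B)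
     (\<lambda>(i, j). A $$ (i div dim_row B, j div dim_col B) * B $$ (i mod dim_row B, j mod dim_col B))"

text \<open>The columns of a matrix stacked on top of each other.\<close>

definition vec_of_mat :: "'a mat \<Rightarrow> 'a vec" where
  "vec_of_mat C = vec (dim_row C * dim_col C) (\<lambda>k. C $$ (k mod dim_row C, k div dim_row C))"

definition vec_perm_mat :: "nat \<Rightarrow> nat \<Rightarrow> real mat" where
  "vec_perm_mat m n = (THE V. V \<in> carrier_mat (m * n) (m * n) \<and>
     (\<forall>C \<in> carrier_mat m n. vec_of_mat (transpose_mat C) = V *\<^sub>v vec_of_mat C))"

lemma vec_perm_mat_entries:
  "vec_perm_mat m n =
     mat (m * n) (m * n) (\<lambda>(p, q). if q = p div n + p mod n * m then 1 else 0)" (is "_ = ?V")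
  and vec_perm_mat_carrier: "vec_perm_mat m n \<in> carrier_mat (m * n) (m * n)"
  and vec_perm_mat_transpose:
    "C \<in> carrier_mat m n \<Longrightarrow> vec_of_mat (transpose_mat C) = vec_perm_mat m n *\<^sub>v vec_of_mat C"
proof -
  let ?N = "m * n"
  have works: "vec_of_mat (transpose_mat C) = ?V *\<^sub>v vec_of_mat C" if C: "C \<in> carrier_mat m n" for C
  proof (rule eq_vecI)
    show "dim_vec (vec_of_mat (transpose_mat C)) = dim_vec (?V *\<^sub>v vec_of_mat C)"
      using C by (simp add: vec_of_mat_def mult.commute)
    fix p assume "p < dim_vec (?V *\<^sub>v vec_of_mat C)"
    then have p: "p < ?N" by simp
    then have n0: "0 < n" by (cases n) auto
    have i: "p div n < m" using p by (simp add: less_mult_imp_div_less)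
    have j: "p mod n < n" using n0 by simp
    let ?q = "p div n + p mod n * m"
    have "Suc (p mod n) * m \<le> n * m" using j by (intro mult_le_mono1) simp
    then have "?q < n * m" using i by simp
    then have q: "?q < ?N" by (simp only: mult.commute)
    have "(?V *\<^sub>v vec_of_mat C) $ p
        = (\<Sum>k = 0..<?N. (if k = ?q then 1 else 0) * vec_of_mat C $ k)"
      using p C by (simp add: scalar_prod_def vec_of_mat_def)
    also have "\<dots> = (\<Sum>k = 0..<?N. if k = ?q then vec_of_mat C $ k else 0)"
      by (rule sum.cong) auto
    also have "\<dots> = vec_of_mat C $ ?q" using q by simp
    also have "\<dots> = C $$ (p div n, p mod n)" using q i C by (simp add: vec_of_mat_def)
    also have "\<dots> = vec_of_mat (transpose_mat C) $ p"
      using p i j C by (simp add: vec_of_mat_def mult.commute)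
    finally show "vec_of_mat (transpose_mat C) $ p = (?V *\<^sub>v vec_of_mat C) $ p" by simp
  qed
  have uniq: "V = ?V" if V: "V \<in> carrier_mat ?N ?N"
    and V_works: "\<forall>C \<in> carrier_mat m n. vec_of_mat (transpose_mat C) = V *\<^sub>v vec_of_mat C" for V
  proof (rule eq_matI)
    fix p k assume "p < dim_row ?V" and "k < dim_col ?V"
    then have p: "p < ?N" and k: "k < ?N" by simp_all
    define C :: "real mat" where "C = mat m n (\<lambda>(i, j). unit_vec ?N k $ (i + j * m))"
    have C: "C \<in> carrier_mat m n" by (simp add: C_def)
    have vC: "vec_of_mat C = unit_vec ?N k"
    proof (rule eq_vecI)
      fix l assume "l < dim_vec (unit_vec ?N k)"
      then have l: "l < m * n" by simp
      then have "0 < m" by (cases m) auto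
      moreover have "l div m < n" using l by (simp add: less_mult_imp_div_less mult.commute)
      ultimately show "vec_of_mat C $ l = unit_vec ?N k $ l"
        using l by (simp add: vec_of_mat_def C_def)
    qed (simp add: vec_of_mat_def C_def)
    have "V *\<^sub>v unit_vec ?N k = ?V *\<^sub>v unit_vec ?N k"
      using V_works[rule_format, OF C] works[OF C] unfolding vC by simp
    then have "(V *\<^sub>v unit_vec ?N k) $ p = (?V *\<^sub>v unit_vec ?N k) $ p" by simp
    then show "V $$ (p, k) = ?V $$ (p, k)" using p k V by simp
  qed (use carrier_matD[OF V] in simp_all)
  show eq: "vec_perm_mat m n = ?V"
    unfolding vec_perm_mat_def
  proof (rule the_equality)
    show "?V \<in> carrier_mat ?N ?N \<and>
      (\<forall>C \<in> carrier_mat m n. vec_of_mat (transpose_mat C) = ?V *\<^sub>v vec_of_mat C)"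
      using works by (intro conjI ballI) simp_all
  qed (use uniq in blast)
  show "vec_perm_mat m n \<in> carrier_mat ?N ?N" by (simp add: eq)
  show "C \<in> carrier_mat m n \<Longrightarrow> vec_of_mat (transpose_mat C) = vec_perm_mat m n *\<^sub>v vec_of_mat C"
    unfolding eq by (rule works)
qed

definition frobenius_norm :: "real mat \<Rightarrow> real" where
  "frobenius_norm M = sqrt (\<Sum>i<dim_row M. \<Sum>j<dim_col M. (M $$ (i, j))\<^sup>2)"

text \<open>Library predicate \<^const>\<open>upper_triangular\<close> reads entries outside the matrix as soon as there
  are at least two more rows than columns; library predicate \<^const>\<open>orthogonal_mat\<close> asks for
  orthogonal nonzero columns only, not for unit length.\<close>

definition upper_triangular_rect :: "'a :: zero mat \<Rightarrow> bool" where
  "upper_triangular_rect M \<longleftrightarrow> (\<forall>i < dim_row M. \<forall>j < dim_col M. j < i \<longrightarrow> M $$ (i, j) = 0)"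

definition real_orthogonal_mat :: "nat \<Rightarrow> real mat \<Rightarrow> bool" where
  "real_orthogonal_mat m Q \<longleftrightarrow> Q \<in> carrier_mat m m \<and>
     transpose_mat Q * Q = 1\<^sub>m m \<and> Q * transpose_mat Q = 1\<^sub>m m"

text \<open>The real roots of a polynomial, repeated according to multiplicity, largest first.\<close>

definition roots_desc :: "real poly \<Rightarrow> real list" where
  "roots_desc p = rev (sorted_list_of_multiset (proots p))"

text \<open>The \<open>i\<close>-th largest singular value, \<open>i = 1, 2, \<dots>\<close>: the square root of the \<open>i\<close>-th largest
  eigenvalue of \<open>M\<^sup>T M\<close>. By convention the value for \<open>i = 0\<close> is infinite.\<close>

definition singular_value :: "nat \<Rightarrow> real mat \<Rightarrow> ereal" where
  "singular_value i M =
     (if i = 0 then \<infinity> else ereal (sqrt (roots_desc (char_poly (transpose_mat M * M)) ! (i - 1))))"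

definition pencil_poly :: "real mat \<Rightarrow> real mat \<Rightarrow> real poly" where
  "pencil_poly M N = det (map_mat (\<lambda>a. [:a:]) M - [:0, 1:] \<cdot>\<^sub>m map_mat (\<lambda>a. [:a:]) N)"

text \<open>The generalized eigenvalues of a regular pencil, i.e. one with \<open>det (M - t N) \<noteq> 0\<close> as a
  polynomial in \<open>t\<close>. The infinite eigenvalue has multiplicity size minus degree, and is listed
  first. The index \<open>i = 1, 2, \<dots>\<close> counts from the largest eigenvalue.\<close>

definition gen_eigenvalue :: "nat \<Rightarrow> real mat \<Rightarrow> real mat \<Rightarrow> ereal" where
  "gen_eigenvalue i M N =
     (replicate (dim_row M - degree (pencil_poly M N)) \<infinity>
       @ map ereal (roots_desc (pencil_poly M N))) ! (i - 1)"

definition MTLS_constraint ::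
  "real mat \<Rightarrow> real mat \<Rightarrow> real vec \<Rightarrow> real mat \<Rightarrow> real vec \<Rightarrow> real vec \<Rightarrow> bool" where
  "MTLS_constraint A1 A2 b E2 f x \<longleftrightarrow>
     E2 \<in> carrier_mat (dim_row A2) (dim_col A2) \<and>
     f \<in> carrier_vec (dim_vec b) \<and>
     x \<in> carrier_vec (dim_col A1 + dim_col A2) \<and>
     A1 *\<^sub>v vec_first x (dim_col A1) + (A2 + E2) *\<^sub>v vec_last x (dim_col A2) = b + f"

definition is_MTLS_solution :: "real mat \<Rightarrow> real mat \<Rightarrow> real vec \<Rightarrow> real vec \<Rightarrow> bool" where
  "is_MTLS_solution A1 A2 b x \<longleftrightarrow>
     (\<exists>E2 f. MTLS_constraint A1 A2 b E2 f x \<and>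
       (\<forall>E2' f' x'. MTLS_constraint A1 A2 b E2' f' x' \<longrightarrow>
          frobenius_norm (E2 @\<^sub>c mat_of_col f) \<le> frobenius_norm (E2' @\<^sub>c mat_of_col f')))"

end

theory Submission
  imports Defs
begin

text \<open>
  Applied to \<open>vec [\<Delta>A, \<Delta>b]\<close>, the matrix \<open>K\<^sub>Z\<^sub>Y\<close> gives
  \<open>- D (\<Delta>A x - \<Delta>b) - P\<^sup>-\<^sup>1 (\<Delta>A)\<^sup>T r\<close>, and \<open>K\<close> gives
  \<open>- P\<^sup>-\<^sup>1 A\<^sup>T H\<^sub>0 (\<Delta>A x - \<Delta>b) - P\<^sup>-\<^sup>1 (\<Delta>A)\<^sup>T r\<close>. Hence the two agree as soon as
  \<open>D = P\<^sup>-\<^sup>1 A\<^sup>T H\<^sub>0\<close>; the lemma \<open>perturbation_matrices_eq\<close> carries this out with Kronecker products.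

  Written out, the remaining identity compares the rank one terms \<open>2 A\<^sup>T r r\<^sup>T / (r\<^sup>T r)\<close> and
  \<open>2 W x r\<^sup>T / \<gamma>\<close>. They are equal because an MTLS solution satisfies
  \<open>\<gamma> A\<^sup>T r = (r\<^sup>T r) W x\<close> (\<open>MTLS_solution_normal_equations\<close>). Indeed the best perturbation for a given
  \<open>y\<close> costs \<open>\<parallel>A y - b\<parallel>\<^sup>2 / (1 + y\<^sup>T W y)\<close> (\<open>MTLS_solution_minimises_quotient\<close>), so \<open>x\<close> minimises
  this quotient, and the equation says that its gradient vanishes at \<open>x\<close>. Inconsistency of
  \<open>A x = b\<close> ensures \<open>r \<noteq> 0\<close>, so that \<open>H\<^sub>0\<close> is a genuine reflection.

  Genericity and full rank serve to make \<open>P\<close> invertible. The QR factorization gives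
  \<open>det P = (det R\<^sub>1\<^sub>1)\<^sup>2 det (R\<^sub>2\<^sub>2\<^sup>T R\<^sub>2\<^sub>2 - \<sigma>\<^sup>2 1)\<close> (\<open>det_block_gram_minus\<close>). Full column rank makes the
  first factor nonzero. Each genericity condition says that \<open>\<sigma>\<^sup>2\<close> lies below the smallest
  eigenvalue of \<open>R\<^sub>2\<^sub>2\<^sup>T R\<^sub>2\<^sub>2\<close>: the first almost literally, the second because the same determinant
  identity, read as an identity of polynomials in the shift, identifies the finite generalized
  eigenvalues of the pencils with squared singular values (\<open>gen_eigenvalue_block_gram\<close>). Counting
  eigenvalues from above needs that the characteristic polynomials of Gram matrices split over
  the reals (\<open>symmetric_mat_size_proots_char_poly\<close>).
\<close>

section \<open>Matrices joined side by side\<close>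

lemma append_cols_carrier:
  "A \<in> carrier_mat m p \<Longrightarrow> B \<in> carrier_mat m q \<Longrightarrow> A @\<^sub>c B \<in> carrier_mat m (p + q)"
  unfolding append_cols_def by auto

lemma append_cols_index:
  assumes "A \<in> carrier_mat m p" "B \<in> carrier_mat m q" "i < m" "j < p + q"
  shows "(A @\<^sub>c B) $$ (i, j) = (if j < p then A $$ (i, j) else B $$ (i, j - p))"
  using assms unfolding append_cols_def by auto

lemma append_cols_mult_vec:
  assumes A: "A \<in> carrier_mat m p" and B: "B \<in> carrier_mat m q"
    and u: "u \<in> carrier_vec p" and v: "v \<in> carrier_vec q"
  shows "(A @\<^sub>c B) *\<^sub>v (u @\<^sub>v v) = A *\<^sub>v u + B *\<^sub>v v"
proof (rule eq_vecI)
  fix i assume "i < dim_vec (A *\<^sub>v u + B *\<^sub>v v)"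
  then have i: "i < m" using B by simp
  have "row (A @\<^sub>c B) i = row A i @\<^sub>v row B i"
    using A B i append_cols_carrier[OF A B]
    by (intro eq_vecI) (auto simp: append_cols_index[OF A B])
  then show "((A @\<^sub>c B) *\<^sub>v (u @\<^sub>v v)) $ i = (A *\<^sub>v u + B *\<^sub>v v) $ i"
    using A B u v i append_cols_carrier[OF A B] scalar_prod_append[of "row A i" p "row B i" q u v]
    by simp
qed (use A B append_cols_carrier[OF A B] in simp)

lemma mult_append_cols:
  assumes C: "C \<in> carrier_mat k m" and A: "A \<in> carrier_mat m p" and B: "B \<in> carrier_mat m q"
  shows "C * (A @\<^sub>c B) = (C * A) @\<^sub>c (C * B)"
proof (rule eq_matI)
  have CA: "C * A \<in> carrier_mat k p" and CB: "C * B \<in> carrier_mat k q" using A B C by simp_all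
  note AB = append_cols_carrier[OF A B]
  fix i j assume "i < dim_row ((C * A) @\<^sub>c (C * B))" "j < dim_col ((C * A) @\<^sub>c (C * B))"
  then have i: "i < k" and j: "j < p + q" using append_cols_carrier[OF CA CB] by auto
  have "col (A @\<^sub>c B) j = (if j < p then col A j else col B (j - p))"
    using AB A B j by (intro eq_vecI) (auto simp: append_cols_index[OF A B])
  then show "(C * (A @\<^sub>c B)) $$ (i, j) = ((C * A) @\<^sub>c (C * B)) $$ (i, j)"
    using i j AB A B C by (simp add: append_cols_index[OF CA CB])
qed (use A B C in \<open>simp_all add: append_cols_def\<close>)

lemma add_append_cols:
  fixes A1 A2 B1 B2 :: "'a :: comm_ring_1 mat"
  assumes "A1 \<in> carrier_mat p q" "A2 \<in> carrier_mat p q" "B1 \<in> carrier_mat p s" "B2 \<in> carrier_mat p s"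
  shows "(A1 @\<^sub>c B1) + (A2 @\<^sub>c B2) = (A1 + A2) @\<^sub>c (B1 + B2)"
  unfolding append_cols_def using assms by (intro eq_matI) auto

lemma uminus_append_cols:
  fixes A B :: "'a :: comm_ring_1 mat"
  assumes "A \<in> carrier_mat p q" "B \<in> carrier_mat p s"
  shows "- (A @\<^sub>c B) = (- A) @\<^sub>c (- B)"
  unfolding append_cols_def using assms by (intro eq_matI) auto

text \<open>Restricts a factorization of \<open>[A, b]\<close> to the columns of \<open>A\<close>.\<close>

lemma left_block_of_append_cols:
  assumes C: "C \<in> carrier_mat (k + p) (k + q)" and D: "D \<in> carrier_mat (k + p) s"
    and R: "R \<in> carrier_mat k k" and X: "X \<in> carrier_mat k q" and X': "X' \<in> carrier_mat k s"
    and Y: "Y \<in> carrier_mat p q" and Y': "Y' \<in> carrier_mat p s"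
    and eq: "C @\<^sub>c D = four_block_mat R (X @\<^sub>c X') (0\<^sub>m p k) (Y @\<^sub>c Y')"
  shows "C = four_block_mat R X (0\<^sub>m p k) Y"
proof (rule eq_matI)
  fix i j assume "i < dim_row (four_block_mat R X (0\<^sub>m p k) Y)" "j < dim_col (four_block_mat R X (0\<^sub>m p k) Y)"
  then have i: "i < k + p" and j: "j < k + q" using R Y by auto
  have "C $$ (i, j) = (C @\<^sub>c D) $$ (i, j)" using i j by (simp add: append_cols_index[OF C D])
  also have "\<dots> = four_block_mat R X (0\<^sub>m p k) Y $$ (i, j)"
    unfolding eq using i j R Y append_cols_carrier[OF Y Y']
    by (auto simp: append_cols_index[OF X X'] append_cols_index[OF Y Y'])
  finally show "C $$ (i, j) = four_block_mat R X (0\<^sub>m p k) Y $$ (i, j)" .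
qed (use C R Y in auto)

lemma mat_of_col_carrier: "v \<in> carrier_vec k \<Longrightarrow> mat_of_col v \<in> carrier_mat k 1"
  by (simp add: mat_of_col_def)

lemma singleton_vec_carrier: "vec_of_list [c] \<in> carrier_vec 1"
  using carrier_vecI[OF dim_vec_of_list[of "[c]"]] by simp

lemma diag_block_mat_pair:
  "diag_block_mat [M, N] = four_block_mat M (0\<^sub>m (dim_row M) (dim_col N)) (0\<^sub>m (dim_row N) (dim_col M)) N"
  by (intro eq_matI) (auto simp: Let_def)

section \<open>Kronecker products with a row vector\<close>

lemma kronecker_prod_carrier:
  "A \<in> carrier_mat p q \<Longrightarrow> B \<in> carrier_mat s t \<Longrightarrow> A \<otimes>\<^sub>k B \<in> carrier_mat (p * s) (q * t)"
  by (auto simp: kronecker_prod_def)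

lemma row_kronecker_index:
  assumes "y \<in> carrier_vec k" "B \<in> carrier_mat p q" "i < p" "j < k * q"
  shows "(mat_of_row y \<otimes>\<^sub>k B) $$ (i, j) = y $ (j div q) * B $$ (i, j mod q)"
  using assms by (simp add: kronecker_prod_def mat_of_row_def less_mult_imp_div_less)

lemma mult_row_kronecker_one:
  fixes B :: "'a :: comm_ring_1 mat"
  assumes y: "y \<in> carrier_vec k" and B: "B \<in> carrier_mat p m"
  shows "B * (mat_of_row y \<otimes>\<^sub>k 1\<^sub>m m) = mat_of_row y \<otimes>\<^sub>k B"
proof (rule eq_matI)
  fix i j assume "i < dim_row (mat_of_row y \<otimes>\<^sub>k B)" "j < dim_col (mat_of_row y \<otimes>\<^sub>k B)"
  then have i: "i < p" and j: "j < k * m" using y B by (simp_all add: kronecker_prod_def)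
  then have jm: "j mod m < m" by (cases m) auto
  have "(B * (mat_of_row y \<otimes>\<^sub>k 1\<^sub>m m)) $$ (i, j)
      = (\<Sum>l = 0..<m. B $$ (i, l) * (mat_of_row y \<otimes>\<^sub>k 1\<^sub>m m) $$ (l, j))"
    using B y i j by (simp add: scalar_prod_def kronecker_prod_def)
  also have "\<dots> = (\<Sum>l = 0..<m. if l = j mod m then B $$ (i, l) * y $ (j div m) else 0)"
    using jm by (intro sum.cong refl) (simp add: row_kronecker_index[OF y one_carrier_mat _ j])
  also have "\<dots> = B $$ (i, j mod m) * y $ (j div m)" using jm by simp
  finally show "(B * (mat_of_row y \<otimes>\<^sub>k 1\<^sub>m m)) $$ (i, j) = (mat_of_row y \<otimes>\<^sub>k B) $$ (i, j)"
    by (simp only: row_kronecker_index[OF y B i j] mult.commute[of "B $$ _"])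
qed (use y B in \<open>simp_all add: kronecker_prod_def\<close>)

lemma row_append_kronecker:
  fixes B :: "'a :: comm_ring_1 mat"
  assumes x: "x \<in> carrier_vec n" and B: "B \<in> carrier_mat p m"
  shows "mat_of_row (x @\<^sub>v vec_of_list [c]) \<otimes>\<^sub>k B = (mat_of_row x \<otimes>\<^sub>k B) @\<^sub>c (c \<cdot>\<^sub>m B)"
proof (rule eq_matI)
  have xc: "x @\<^sub>v vec_of_list [c] \<in> carrier_vec (n + 1)"
    using append_carrier_vec[OF x singleton_vec_carrier] by simp
  fix i j
  assume "i < dim_row ((mat_of_row x \<otimes>\<^sub>k B) @\<^sub>c (c \<cdot>\<^sub>m B))"
    "j < dim_col ((mat_of_row x \<otimes>\<^sub>k B) @\<^sub>c (c \<cdot>\<^sub>m B))"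
  then have i: "i < p" and j: "j < n * m + m"
    using x B by (simp_all add: append_cols_def kronecker_prod_def)
  have j': "j < (n + 1) * m" using j by simp
  show "(mat_of_row (x @\<^sub>v vec_of_list [c]) \<otimes>\<^sub>k B) $$ (i, j)
      = ((mat_of_row x \<otimes>\<^sub>k B) @\<^sub>c (c \<cdot>\<^sub>m B)) $$ (i, j)"
  proof (cases "j < n * m")
    case True
    then have "j div m < n" by (rule less_mult_imp_div_less)
    then show ?thesis
      using i j x B True row_kronecker_index[OF xc B i j'] row_kronecker_index[OF x B i True]
      by (simp add: append_cols_def kronecker_prod_def)
  next
    case False
    then have "j div m = n"
      using j by (auto intro!: div_nat_eqI simp: mult.commute)
    then have "j div m = n" "j mod m = j - n * m"
      by (simp_all add: modulo_nat_def)
    then show ?thesis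
      using i j x B False row_kronecker_index[OF xc B i j']
      by (simp add: append_cols_def kronecker_prod_def)
  qed
qed (use x B in \<open>simp_all add: append_cols_def kronecker_prod_def\<close>)

text \<open>Both sides send \<open>vec (\<Delta>A)\<close> to \<open>C (\<Delta>A)\<^sup>T r\<close>: on the left the permutation first
  transposes \<open>\<Delta>A\<close>, on the right \<open>1 \<otimes> r\<^sup>T\<close> already takes the scalar product of \<open>r\<close> with
  every column. The proof compares entries; column \<open>j = k + l m\<close> stands for position
  \<open>(k, l)\<close> of \<open>\<Delta>A\<close>, and the permutation moves it to \<open>l + k n\<close>.\<close>

lemma row_kronecker_vec_perm:
  assumes r: "r \<in> carrier_vec m" and C: "C \<in> carrier_mat p n"
  shows "(mat_of_row r \<otimes>\<^sub>k C) * vec_perm_mat m n = C * (1\<^sub>m n \<otimes>\<^sub>k mat_of_row r)"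
proof (rule eq_matI)
  have rC: "mat_of_row r \<otimes>\<^sub>k C \<in> carrier_mat p (m * n)"
    using kronecker_prod_carrier[OF mat_of_row_carrier(1)[OF r] C] by simp
  have Ir: "1\<^sub>m n \<otimes>\<^sub>k mat_of_row r \<in> carrier_mat n (n * m)"
    using kronecker_prod_carrier[OF one_carrier_mat mat_of_row_carrier(1)[OF r], of n] by simp
  note V = vec_perm_mat_carrier[of m n]
  fix i j assume "i < dim_row (C * (1\<^sub>m n \<otimes>\<^sub>k mat_of_row r))" "j < dim_col (C * (1\<^sub>m n \<otimes>\<^sub>k mat_of_row r))"
  then have i: "i < p" and j: "j < n * m" using C Ir by auto
  define k l where "k = j mod m" and "l = j div m"
  have m0: "0 < m" using j by (cases m) auto
  have k: "k < m" and l: "l < n" using m0 j by (simp_all add: k_def l_def less_mult_imp_div_less)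
  have jkl: "j = k + l * m" by (simp add: k_def l_def)
  define q0 where "q0 = l + k * n"
  have q0: "q0 < m * n"
  proof -
    have "q0 < n + k * n" using l by (simp add: q0_def)
    also have "\<dots> = Suc k * n" by simp
    also have "\<dots> \<le> m * n" using k by (intro mult_le_mono1) simp
    finally show ?thesis .
  qed
  have perm: "j = q div n + q mod n * m \<longleftrightarrow> q = q0" if q: "q < m * n" for q
  proof
    assume "q = q0" then show "j = q div n + q mod n * m" using l by (simp add: q0_def jkl)
  next
    assume eq: "j = q div n + q mod n * m"
    have "q div n < m" using q by (rule less_mult_imp_div_less)
    then have "k = q div n" "l = q mod n" unfolding k_def l_def eq by simp_all
    then show "q = q0" unfolding q0_def by simp
  qed
  have "((mat_of_row r \<otimes>\<^sub>k C) * vec_perm_mat m n) $$ (i, j)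
      = (\<Sum>q = 0..<m * n. (mat_of_row r \<otimes>\<^sub>k C) $$ (i, q) * vec_perm_mat m n $$ (q, j))"
    using i j rC V by (simp add: scalar_prod_def mult.commute)
  also have "\<dots> = (\<Sum>q = 0..<m * n. if q = q0 then r $ (q div n) * C $$ (i, q mod n) else 0)"
    using j by (intro sum.cong refl)
      (simp add: row_kronecker_index[OF r C i] vec_perm_mat_entries perm mult.commute[of n m])
  also have "\<dots> = r $ k * C $$ (i, l)" using q0 l by (simp add: q0_def)
  finally have lhs: "((mat_of_row r \<otimes>\<^sub>k C) * vec_perm_mat m n) $$ (i, j) = r $ k * C $$ (i, l)" .
  have "(C * (1\<^sub>m n \<otimes>\<^sub>k mat_of_row r)) $$ (i, j)
      = (\<Sum>s = 0..<n. C $$ (i, s) * (1\<^sub>m n \<otimes>\<^sub>k mat_of_row r) $$ (s, j))"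
    using i j C Ir by (simp add: scalar_prod_def)
  also have "\<dots> = (\<Sum>s = 0..<n. if s = l then C $$ (i, s) * r $ k else 0)"
    using j r l k by (intro sum.cong refl)
      (auto simp: kronecker_prod_def mat_of_row_def k_def l_def)
  also have "\<dots> = r $ k * C $$ (i, l)" using l by simp
  finally show "((mat_of_row r \<otimes>\<^sub>k C) * vec_perm_mat m n) $$ (i, j)
      = (C * (1\<^sub>m n \<otimes>\<^sub>k mat_of_row r)) $$ (i, j)" using lhs by simp
qed (use r C vec_perm_mat_carrier[of m n] in \<open>simp_all add: kronecker_prod_def mult.commute\<close>)

text \<open>The algebraic core: as soon as \<open>D\<close> factors as \<open>C B\<close>, both matrices send
  \<open>vec [\<Delta>A, \<Delta>b]\<close> to \<open>- D (\<Delta>A x - \<Delta>b) - C (\<Delta>A)\<^sup>T r\<close>. It is applied with \<open>C = P\<^sup>-\<^sup>1\<close> and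
  \<open>B = A\<^sup>T H\<^sub>0\<close>.\<close>

lemma perturbation_matrices_eq:
  fixes C B D :: "real mat"
  assumes C: "C \<in> carrier_mat n n" and B: "B \<in> carrier_mat n m"
    and x: "x \<in> carrier_vec n" and r: "r \<in> carrier_vec m" and D: "D = C * B"
  shows "(- (mat_of_row x \<otimes>\<^sub>k D) - (mat_of_row r \<otimes>\<^sub>k C) * vec_perm_mat m n) @\<^sub>c D
    = - (C * (B * (mat_of_row (x @\<^sub>v vec_of_list [-1]) \<otimes>\<^sub>k 1\<^sub>m m)
        + ((1\<^sub>m n \<otimes>\<^sub>k mat_of_row r) @\<^sub>c 0\<^sub>m n m)))"
proof -
  let ?G = "mat_of_row (x @\<^sub>v vec_of_list [-1]) \<otimes>\<^sub>k 1\<^sub>m m :: real mat"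
  let ?N = "1\<^sub>m n \<otimes>\<^sub>k mat_of_row r" and ?xD = "mat_of_row x \<otimes>\<^sub>k D"
  have Dc: "D \<in> carrier_mat n m" using C B D by simp
  have xc: "x @\<^sub>v vec_of_list [-1] \<in> carrier_vec (n + 1)"
    using append_carrier_vec[OF x singleton_vec_carrier[of "-1"]] .
  have G: "?G \<in> carrier_mat m (n * m + m)"
    using kronecker_prod_carrier[OF mat_of_row_carrier(1)[OF xc] one_carrier_mat, of m]
    by (simp add: add.commute)
  have N: "?N \<in> carrier_mat n (n * m)"
    using kronecker_prod_carrier[OF one_carrier_mat mat_of_row_carrier(1)[OF r], of n] by simp
  have xD: "?xD \<in> carrier_mat n (n * m)"
    using kronecker_prod_carrier[OF mat_of_row_carrier(1)[OF x] Dc] by simp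
  have CN: "C * ?N \<in> carrier_mat n (n * m)" using C N by simp
  have "C * (B * ?G) = D * ?G" using C B G D by (simp add: assoc_mult_mat[of _ n n _ m])
  also have "\<dots> = mat_of_row (x @\<^sub>v vec_of_list [-1]) \<otimes>\<^sub>k D"
    by (rule mult_row_kronecker_one[OF xc Dc])
  also have "\<dots> = ?xD @\<^sub>c (- D)"
    unfolding row_append_kronecker[OF x Dc] using Dc by (intro arg_cong2[where f = append_cols] refl eq_matI) auto
  finally have CBG: "C * (B * ?G) = ?xD @\<^sub>c (- D)" .
  have BG: "B * ?G \<in> carrier_mat n (n * m + m)" using B G by simp
  have N0: "?N @\<^sub>c 0\<^sub>m n m \<in> carrier_mat n (n * m + m)"
    by (rule append_cols_carrier[OF N zero_carrier_mat])
  have "- (C * (B * ?G + (?N @\<^sub>c 0\<^sub>m n m))) = - (C * (B * ?G) + C * (?N @\<^sub>c 0\<^sub>m n m))"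
    by (simp only: mult_add_distrib_mat[OF C BG N0])
  also have "\<dots> = - ((?xD @\<^sub>c (- D)) + ((C * ?N) @\<^sub>c 0\<^sub>m n m))"
    unfolding CBG mult_append_cols[OF C N zero_carrier_mat] using C by simp
  also have "\<dots> = (- (?xD + C * ?N)) @\<^sub>c (- (- D + 0\<^sub>m n m))"
    using xD CN Dc by (simp add: add_append_cols[of _ n "n * m" _ _ m] uminus_append_cols[of _ n "n * m" _ m])
  also have "\<dots> = (- ?xD - C * ?N) @\<^sub>c D"
    using xD CN Dc
    by (intro arg_cong2[where f = append_cols] eq_matI) (auto simp del: index_mult_mat)
  finally show ?thesis unfolding row_kronecker_vec_perm[OF r C] by simp
qed

section \<open>First order optimality of an MTLS solution\<close>

lemma frobenius_norm_square:
  assumes "M \<in> carrier_mat p q"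
  shows "(frobenius_norm M)\<^sup>2 = (\<Sum>i<p. \<Sum>j<q. (M $$ (i, j))\<^sup>2)"
  using assms by (auto simp: frobenius_norm_def intro!: real_sqrt_pow2 sum_nonneg)

lemma scalar_prod_self: "v \<in> carrier_vec k \<Longrightarrow> v \<bullet> v = (\<Sum>i<k. (v $ i)\<^sup>2)" for v :: "real vec"
  by (simp add: scalar_prod_def power2_eq_square lessThan_atLeast0)

lemma scalar_prod_self_nonneg: "0 \<le> v \<bullet> v" for v :: "real vec"
  using conjugate_square_ge_0_vec[of v] by simp

text \<open>Cauchy-Schwarz in every row. It is derived from a nonnegative sum of squares,
  \<open>\<Sum>\<^sub>j (\<parallel>z\<parallel>\<^sup>2 M\<^sub>i\<^sub>j - (M z)\<^sub>i z\<^sub>j)\<^sup>2\<close>.\<close>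

lemma norm_mult_mat_vec_le:
  fixes M :: "real mat"
  assumes M: "M \<in> carrier_mat p q" and z: "z \<in> carrier_vec q"
  shows "(M *\<^sub>v z) \<bullet> (M *\<^sub>v z) \<le> (frobenius_norm M)\<^sup>2 * (z \<bullet> z)"
proof -
  let ?s = "\<lambda>i. (M *\<^sub>v z) $ i"
  have row: "(?s i)\<^sup>2 \<le> (\<Sum>j<q. (M $$ (i, j))\<^sup>2) * (z \<bullet> z)" if i: "i < p" for i
  proof (cases "z \<bullet> z = 0")
    case True
    then have "z = 0\<^sub>v q" using conjugate_square_eq_0_vec[OF z] by simp
    then show ?thesis using M i by simp
  next
    case False
    let ?a = "\<lambda>j. M $$ (i, j)"
    have s: "?s i = (\<Sum>j<q. ?a j * z $ j)"
      using M z i by (simp add: scalar_prod_def lessThan_atLeast0)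
    have "0 \<le> (\<Sum>j<q. ((z \<bullet> z) * ?a j - ?s i * z $ j)\<^sup>2)" by (intro sum_nonneg) simp
    also have "\<dots> = (\<Sum>j<q. (z \<bullet> z)\<^sup>2 * (?a j)\<^sup>2 - 2 * (z \<bullet> z) * ?s i * (?a j * z $ j)
        + (?s i)\<^sup>2 * (z $ j)\<^sup>2)"
      by (intro sum.cong) (auto simp: power2_eq_square algebra_simps)
    also have "\<dots> = (z \<bullet> z)\<^sup>2 * (\<Sum>j<q. (?a j)\<^sup>2) - 2 * (z \<bullet> z) * ?s i * ?s i
        + (?s i)\<^sup>2 * (z \<bullet> z)"
      unfolding sum.distrib sum_subtractf sum_distrib_left[symmetric] s[symmetric]
        scalar_prod_self[OF z, symmetric] ..
    also have "\<dots> = (z \<bullet> z) * ((\<Sum>j<q. (?a j)\<^sup>2) * (z \<bullet> z) - (?s i)\<^sup>2)"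
      by (simp add: power2_eq_square algebra_simps)
    finally show ?thesis
      using False scalar_prod_self_nonneg[of z] by (simp add: zero_le_mult_iff)
  qed
  have "(M *\<^sub>v z) \<bullet> (M *\<^sub>v z) = (\<Sum>i<p. (?s i)\<^sup>2)"
    by (rule scalar_prod_self[OF mult_mat_vec_carrier[OF M z]])
  also have "\<dots> \<le> (\<Sum>i<p. (\<Sum>j<q. (M $$ (i, j))\<^sup>2) * (z \<bullet> z))"
    by (intro sum_mono row) simp
  finally show ?thesis by (simp add: frobenius_norm_square[OF M] sum_distrib_right)
qed

text \<open>Eliminating the perturbation: with \<open>z = (u\<^sub>2, -1)\<close>, the constraint for \<open>u\<close> reads
  \<open>[E\<^sub>2, f] z = b - A u\<close>, so the squared Frobenius norm is at least \<open>\<parallel>A u - b\<parallel>\<^sup>2 / (1 + \<parallel>u\<^sub>2\<parallel>\<^sup>2)\<close>,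
  and the rank one matrix \<open>- (A u - b) z\<^sup>T / \<parallel>z\<parallel>\<^sup>2\<close> attains this bound. An MTLS solution therefore
  minimises the quotient; the inequality is stated without division.\<close>

lemma MTLS_solution_minimises_quotient:
  assumes A1: "A1 \<in> carrier_mat m n1" and A2: "A2 \<in> carrier_mat m n2"
    and b: "b \<in> carrier_vec m" and sol: "is_MTLS_solution A1 A2 b x"
    and y: "y \<in> carrier_vec (n1 + n2)"
  defines "res \<equiv> \<lambda>u. (A1 @\<^sub>c A2) *\<^sub>v u - b"
    and "wt \<equiv> \<lambda>u. 1 + vec_last u n2 \<bullet> vec_last u n2"
  shows "x \<in> carrier_vec (n1 + n2)"
    and "(res x \<bullet> res x) * wt y \<le> (res y \<bullet> res y) * wt x"
proof -
  note A = append_cols_carrier[OF A1 A2]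
  have wt_pos: "0 < wt u" for u
    unfolding wt_def using scalar_prod_self_nonneg[of "vec_last u n2"] by simp
  have split: "(A1 @\<^sub>c A2) *\<^sub>v u = A1 *\<^sub>v vec_first u n1 + A2 *\<^sub>v vec_last u n2"
    if "u \<in> carrier_vec (n1 + n2)" for u
    using append_cols_mult_vec[OF A1 A2, of "vec_first u n1" "vec_last u n2"] that by simp
  define z where "z u = vec_last u n2 @\<^sub>v vec_of_list [-1 :: real]" for u :: "real vec"
  have z: "z u \<in> carrier_vec (n2 + 1)" for u
    using append_carrier_vec[OF vec_last_carrier[of u n2] singleton_vec_carrier[of "-1 :: real"]]
    by (simp add: z_def)
  have zz: "z u \<bullet> z u = wt u" for u
  proof -
    have "z u \<bullet> z u = vec_last u n2 \<bullet> vec_last u n2 + vec_of_list [-1 :: real] \<bullet> vec_of_list [-1]"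
      unfolding z_def using singleton_vec_carrier[of "-1 :: real"]
      by (intro scalar_prod_append[of _ n2 _ 1]) simp_all
    also have "vec_of_list [-1 :: real] \<bullet> vec_of_list [-1] = 1" by (simp add: scalar_prod_def)
    finally show ?thesis by (simp add: wt_def)
  qed
  from sol obtain E f where con: "MTLS_constraint A1 A2 b E f x"
    and opt: "\<And>E' f' x'. MTLS_constraint A1 A2 b E' f' x' \<Longrightarrow>
      frobenius_norm (E @\<^sub>c mat_of_col f) \<le> frobenius_norm (E' @\<^sub>c mat_of_col f')"
    unfolding is_MTLS_solution_def by blast
  from con have E: "E \<in> carrier_mat m n2" and f: "f \<in> carrier_vec m"
    and x: "x \<in> carrier_vec (n1 + n2)"
    and eq: "A1 *\<^sub>v vec_first x n1 + (A2 + E) *\<^sub>v vec_last x n2 = b + f"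
    using A1 A2 b unfolding MTLS_constraint_def by auto
  show "x \<in> carrier_vec (n1 + n2)" by (rule x)
  let ?F = "(frobenius_norm (E @\<^sub>c mat_of_col f))\<^sup>2"
  have col_mult: "mat_of_col g *\<^sub>v vec_of_list [-1] = - g" if "g \<in> carrier_vec m" for g :: "real vec"
    using that by (intro eq_vecI) (auto simp: mat_of_col_def scalar_prod_def)
  have apply_z: "(B @\<^sub>c mat_of_col g) *\<^sub>v z u = B *\<^sub>v vec_last u n2 - g"
    if B: "B \<in> carrier_mat m n2" and g: "g \<in> carrier_vec m" for B g u
    unfolding z_def
    by (subst append_cols_mult_vec[OF B mat_of_col_carrier[OF g]])
      (use B g col_mult[OF g] singleton_vec_carrier[of "-1 :: real"] in \<open>auto intro!: eq_vecI\<close>)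
  have "(E @\<^sub>c mat_of_col f) *\<^sub>v z x = - res x"
  proof (unfold apply_z[OF E f], rule eq_vecI)
    fix i assume "i < dim_vec (- res x)"
    then have i: "i < m" using b by (simp add: res_def)
    have "(A1 *\<^sub>v vec_first x n1 + (A2 + E) *\<^sub>v vec_last x n2) $ i = (b + f) $ i" by (simp add: eq)
    then show "(E *\<^sub>v vec_last x n2 - f) $ i = (- res x) $ i"
      using i A1 A2 E f b
      by (simp add: res_def split[OF x] add_mult_distrib_mat_vec[OF A2 E])
  qed (use E f b in \<open>simp add: res_def\<close>)
  then have lower: "res x \<bullet> res x \<le> ?F * wt x"
    using norm_mult_mat_vec_le[OF append_cols_carrier[OF E mat_of_col_carrier[OF f]] z, of x]
    by (simp add: zz)
  \<comment> \<open>The cheapest perturbation that makes \<open>y\<close> feasible.\<close>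
  define E' where "E' = mat m n2 (\<lambda>(i, j). - (res y $ i * vec_last y n2 $ j / wt y))"
  define f' where "f' = (1 / wt y) \<cdot>\<^sub>v res y"
  have res: "res y \<in> carrier_vec m" unfolding res_def using mult_mat_vec_carrier[OF A y] b by simp
  have E': "E' \<in> carrier_mat m n2" by (simp add: E'_def)
  have f': "f' \<in> carrier_vec m" using res by (simp add: f'_def)
  have E'y: "E' *\<^sub>v vec_last y n2 = f' - res y"
  proof (rule eq_vecI)
    fix i assume "i < dim_vec (f' - res y)"
    then have i: "i < m" using res by simp
    have "(E' *\<^sub>v vec_last y n2) $ i = - (res y $ i / wt y) * (vec_last y n2 \<bullet> vec_last y n2)"
      using i by (simp add: E'_def scalar_prod_def sum_distrib_left sum_negf mult.assoc)
    also have "vec_last y n2 \<bullet> vec_last y n2 = wt y - 1" by (simp add: wt_def)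
    finally show "(E' *\<^sub>v vec_last y n2) $ i = (f' - res y) $ i"
      using wt_pos[of y] i res by (simp add: f'_def field_simps)
  qed (use E' res in simp)
  have con': "MTLS_constraint A1 A2 b E' f' y"
    unfolding MTLS_constraint_def
  proof (intro conjI)
    show "A1 *\<^sub>v vec_first y (dim_col A1) + (A2 + E') *\<^sub>v vec_last y (dim_col A2) = b + f'"
      using A1 A2 E' E'y b f' res
      by (auto intro!: eq_vecI simp: add_mult_distrib_mat_vec[OF A2 E'])
        (auto simp: res_def split[OF y])
  qed (use A1 A2 E' f' b y in auto)
  have entries: "((E' @\<^sub>c mat_of_col f') $$ (i, j))\<^sup>2 = (res y $ i)\<^sup>2 / (wt y)\<^sup>2 * (z y $ j)\<^sup>2"
    if "i < m" "j < n2 + 1" for i j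
  proof -
    have "(E' @\<^sub>c mat_of_col f') $$ (i, j) = - (res y $ i / wt y) * z y $ j"
      unfolding append_cols_index[OF E' mat_of_col_carrier[OF f'] that]
      using that res by (auto simp: E'_def z_def mat_of_col_def f'_def)
    then show ?thesis by (simp add: power_mult_distrib power_divide)
  qed
  have "?F \<le> (frobenius_norm (E' @\<^sub>c mat_of_col f'))\<^sup>2"
    using opt[OF con'] by (rule power_mono) (simp add: frobenius_norm_def sum_nonneg)
  also have "\<dots> = (\<Sum>i<m. \<Sum>j<n2 + 1. (res y $ i)\<^sup>2 / (wt y)\<^sup>2 * (z y $ j)\<^sup>2)"
    unfolding frobenius_norm_square[OF append_cols_carrier[OF E' mat_of_col_carrier[OF f']]]
    by (intro sum.cong refl entries) auto
  also have "\<dots> = (res y \<bullet> res y) / (wt y)\<^sup>2 * wt y"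
    unfolding zz[symmetric, of y] scalar_prod_self[OF z] scalar_prod_self[OF res]
      sum_distrib_left[symmetric] sum_distrib_right[symmetric] sum_divide_distrib[symmetric] ..
  also have "\<dots> = (res y \<bullet> res y) / wt y"
    using wt_pos[of y] by (simp add: power2_eq_square)
  finally have upper: "?F \<le> (res y \<bullet> res y) / wt y" .
  have "(res x \<bullet> res x) * wt y \<le> ?F * wt x * wt y"
    using lower wt_pos[of y] by simp
  also have "\<dots> = (?F * wt y) * wt x" by simp
  also have "\<dots> \<le> (res y \<bullet> res y) * wt x"
    using upper wt_pos[of x] wt_pos[of y] by (intro mult_right_mono) (simp_all add: field_simps)
  finally show "(res x \<bullet> res x) * wt y \<le> (res y \<bullet> res y) * wt x" .
qed

text \<open>First order condition at \<open>t = 0\<close>, which avoids differentiation: a step of length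
  \<open>a / (1 + |c|)\<close> against the sign of \<open>a\<close> would make the value negative.\<close>

lemma quadratic_nonneg_imp_linear_zero:
  fixes a c :: real
  assumes "\<And>t. 0 \<le> t * a + t\<^sup>2 * c"
  shows "a = 0"
proof (rule ccontr)
  assume a: "a \<noteq> 0"
  define d where "d = 1 + \<bar>c\<bar>"
  have d: "d \<noteq> 0" "c - d < 0" by (simp_all add: d_def)
  have "0 \<le> (- a / d) * a + (- a / d)\<^sup>2 * c" by (rule assms)
  also have "\<dots> = a\<^sup>2 * (c - d) / d\<^sup>2" using d(1) by (simp add: field_simps power2_eq_square)
  finally have "0 \<le> a\<^sup>2 * (c - d)" using d(1) by (simp add: zero_le_divide_iff)
  then show False using a d(2) by (simp add: zero_le_mult_iff)
qed

text \<open>The weight \<open>x\<^sup>T W x\<close> of the statement is \<open>\<parallel>x\<^sub>2\<parallel>\<^sup>2\<close>.\<close>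

lemma quadratic_form_lower_identity:
  fixes u :: "real vec"
  assumes u: "u \<in> carrier_vec (p + q)"
  shows "u \<bullet> (four_block_mat (0\<^sub>m p p) (0\<^sub>m p q) (0\<^sub>m q p) (1\<^sub>m q) *\<^sub>v u)
    = vec_last u q \<bullet> vec_last u q"
proof -
  let ?W = "four_block_mat (0\<^sub>m p p) (0\<^sub>m p q) (0\<^sub>m q p) (1\<^sub>m q) :: real mat"
  have "?W *\<^sub>v (vec_first u p @\<^sub>v vec_last u q) = 0\<^sub>v p @\<^sub>v vec_last u q"
    by (subst four_block_mat_mult_vec[OF zero_carrier_mat zero_carrier_mat zero_carrier_mat one_carrier_mat]) auto
  then have "u \<bullet> (?W *\<^sub>v u) = (vec_first u p @\<^sub>v vec_last u q) \<bullet> (0\<^sub>v p @\<^sub>v vec_last u q)"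
    using u by simp
  also have "\<dots> = vec_last u q \<bullet> vec_last u q"
    by (subst scalar_prod_append[of _ p _ q]) auto
  finally show ?thesis .
qed

text \<open>The gradient of the quotient vanishes at a minimiser. This yields
  \<open>A\<^sup>T r = (r\<^sup>T r / \<gamma>) W x\<close>; the factor \<open>r\<^sup>T r / \<gamma>\<close> is the minimal value
  itself. The proof moves from \<open>x\<close> in the direction \<open>g\<close> of the presumed difference of the two sides
  and concludes \<open>g\<^sup>T g = 0\<close>.\<close>

lemma MTLS_solution_normal_equations:
  assumes A1: "A1 \<in> carrier_mat m n1" and A2: "A2 \<in> carrier_mat m n2"
    and b: "b \<in> carrier_vec m" and sol: "is_MTLS_solution A1 A2 b x"
  defines "A \<equiv> A1 @\<^sub>c A2"
    and "W \<equiv> four_block_mat (0\<^sub>m n1 n1) (0\<^sub>m n1 n2) (0\<^sub>m n2 n1) (1\<^sub>m n2)"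
  defines "r \<equiv> A *\<^sub>v x - b"
  shows "(1 + x \<bullet> (W *\<^sub>v x)) \<cdot>\<^sub>v (transpose_mat A *\<^sub>v r) = (r \<bullet> r) \<cdot>\<^sub>v (W *\<^sub>v x)"
proof -
  let ?n = "n1 + n2"
  have A: "A \<in> carrier_mat m ?n" unfolding A_def by (rule append_cols_carrier[OF A1 A2])
  have W: "W \<in> carrier_mat ?n ?n" by (simp add: W_def)
  have Wt: "transpose_mat W = W" unfolding W_def
    by (subst transpose_four_block_mat[OF zero_carrier_mat zero_carrier_mat zero_carrier_mat one_carrier_mat]) simp
  have x: "x \<in> carrier_vec ?n"
    by (rule MTLS_solution_minimises_quotient(1)[OF A1 A2 b sol, of "0\<^sub>v ?n"]) simp
  have r: "r \<in> carrier_vec m" unfolding r_def using mult_mat_vec_carrier[OF A x] b by simp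
  have Wu: "u \<bullet> (W *\<^sub>v u) = vec_last u n2 \<bullet> vec_last u n2" if "u \<in> carrier_vec ?n" for u
    unfolding W_def by (rule quadratic_form_lower_identity[OF that])
  define \<gamma> where "\<gamma> = 1 + x \<bullet> (W *\<^sub>v x)"
  define g where "g = \<gamma> \<cdot>\<^sub>v (transpose_mat A *\<^sub>v r) - (r \<bullet> r) \<cdot>\<^sub>v (W *\<^sub>v x)"
  have g: "g \<in> carrier_vec ?n" using A W x r by (simp add: g_def)
  \<comment> \<open>Along \<open>x + t g\<close> the minimality inequality is quadratic in \<open>t\<close> with linear
    coefficient \<open>2 g\<^sup>T g\<close> and quadratic coefficient \<open>c\<close>.\<close>
  define c where "c = \<gamma> * ((A *\<^sub>v g) \<bullet> (A *\<^sub>v g)) - (r \<bullet> r) * (g \<bullet> (W *\<^sub>v g))"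
  have Ag: "A *\<^sub>v g \<in> carrier_vec m" and Wg: "W *\<^sub>v g \<in> carrier_vec ?n" and Wx: "W *\<^sub>v x \<in> carrier_vec ?n"
    using A W g x by simp_all
  have "0 \<le> t * (2 * (g \<bullet> g)) + t\<^sup>2 * c" for t
  proof -
    define y where "y = x + t \<cdot>\<^sub>v g"
    have y: "y \<in> carrier_vec ?n" using x g by (simp add: y_def)
    have res: "A *\<^sub>v y - b = r + t \<cdot>\<^sub>v (A *\<^sub>v g)"
      using A x g b by (auto simp: y_def r_def mult_add_distrib_mat_vec[of A m ?n] mult_mat_vec[of A m ?n] intro!: eq_vecI)
    have Wy: "W *\<^sub>v y = W *\<^sub>v x + t \<cdot>\<^sub>v (W *\<^sub>v g)"
      using W x g by (auto simp: y_def mult_add_distrib_mat_vec[of W ?n ?n] mult_mat_vec[of W ?n ?n])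
    have rr: "(A *\<^sub>v y - b) \<bullet> (A *\<^sub>v y - b)
        = r \<bullet> r + 2 * t * (r \<bullet> (A *\<^sub>v g)) + t\<^sup>2 * ((A *\<^sub>v g) \<bullet> (A *\<^sub>v g))"
      unfolding res using r Ag comm_scalar_prod[OF Ag r]
      by (simp add: add_scalar_prod_distrib[of _ m] scalar_prod_add_distrib[of _ m] power2_eq_square algebra_simps)
    have "x \<bullet> (W *\<^sub>v g) = g \<bullet> (W *\<^sub>v x)"
      using transpose_vec_mult_scalar[OF W g x] comm_scalar_prod[OF Wx g] by (simp add: Wt)
    then have yy: "y \<bullet> (W *\<^sub>v y) = x \<bullet> (W *\<^sub>v x) + 2 * t * (g \<bullet> (W *\<^sub>v x)) + t\<^sup>2 * (g \<bullet> (W *\<^sub>v g))"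
      unfolding Wy unfolding y_def using x g Wx Wg
      by (simp add: add_scalar_prod_distrib[of _ ?n] scalar_prod_add_distrib[of _ ?n] power2_eq_square algebra_simps)
    have gg: "g \<bullet> g = \<gamma> * (r \<bullet> (A *\<^sub>v g)) - (r \<bullet> r) * (g \<bullet> (W *\<^sub>v x))"
    proof -
      have "g \<bullet> g = (\<gamma> \<cdot>\<^sub>v (transpose_mat A *\<^sub>v r) - (r \<bullet> r) \<cdot>\<^sub>v (W *\<^sub>v x)) \<bullet> g" by (simp add: g_def)
      also have "\<dots> = \<gamma> * ((transpose_mat A *\<^sub>v r) \<bullet> g) - (r \<bullet> r) * ((W *\<^sub>v x) \<bullet> g)"
        using A r g Wx by (subst minus_scalar_prod_distrib[of _ ?n]) auto
      finally show ?thesis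
        using transpose_vec_mult_scalar[OF A g r] comm_scalar_prod[OF Wx g] by simp
    qed
    have "(r \<bullet> r) * (1 + y \<bullet> (W *\<^sub>v y)) \<le> ((A *\<^sub>v y - b) \<bullet> (A *\<^sub>v y - b)) * \<gamma>"
      using MTLS_solution_minimises_quotient(2)[OF A1 A2 b sol y]
      by (simp add: Wu[OF x] Wu[OF y] A_def r_def \<gamma>_def)
    then show ?thesis
      unfolding rr yy gg c_def \<gamma>_def by (simp add: algebra_simps)
  qed
  then have "2 * (g \<bullet> g) = 0" by (rule quadratic_nonneg_imp_linear_zero)
  then have "g = 0\<^sub>v ?n" using conjugate_square_eq_0_vec[OF g] by simp
  then have "g $ i = 0" if "i < ?n" for i using that by simp
  then show ?thesis
    unfolding \<gamma>_def[symmetric] using A W x r by (intro eq_vecI) (auto simp: g_def)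
qed

text \<open>The correction terms of the two formulae, one built from \<open>A\<^sup>T r\<close> and the other from
  \<open>W x\<close>, agree because the normal equations make these vectors parallel, with the ratio
  that matches the two scalar factors.\<close>

lemma transpose_mult_reflector:
  fixes A :: "real mat"
  assumes A: "A \<in> carrier_mat m n" and r: "r \<in> carrier_vec m" and w: "w \<in> carrier_vec n"
    and normal: "\<gamma> \<cdot>\<^sub>v (transpose_mat A *\<^sub>v r) = (r \<bullet> r) \<cdot>\<^sub>v w"
    and \<gamma>: "\<gamma> \<noteq> 0" and r0: "r \<bullet> r \<noteq> 0"
  shows "transpose_mat A * (1\<^sub>m m - (2 / (r \<bullet> r)) \<cdot>\<^sub>m (mat_of_col r * mat_of_row r))
    = transpose_mat A - (2 / \<gamma>) \<cdot>\<^sub>m (mat_of_col w * mat_of_row r)"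
proof -
  let ?At = "transpose_mat A" and ?c = "mat_of_col r" and ?r = "mat_of_row r"
  have At: "?At \<in> carrier_mat n m" using A by simp
  have c: "?c \<in> carrier_mat m 1" and rr: "?r \<in> carrier_mat 1 m"
    using mat_of_col_carrier[OF r] r by simp_all
  have cr: "?c * ?r \<in> carrier_mat m m" using c rr by simp
  have "?At * (1\<^sub>m m - (2 / (r \<bullet> r)) \<cdot>\<^sub>m (?c * ?r)) = ?At - (2 / (r \<bullet> r)) \<cdot>\<^sub>m ((?At * ?c) * ?r)"
    unfolding mult_minus_distrib_mat[OF At one_carrier_mat smult_carrier_mat[OF cr]]
      mult_smult_distrib[OF At cr] assoc_mult_mat[OF At c rr] right_mult_one_mat[OF At] ..
  also have "(2 / (r \<bullet> r)) \<cdot>\<^sub>m ((?At * ?c) * ?r) = (2 / \<gamma>) \<cdot>\<^sub>m (mat_of_col w * ?r)"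
  proof (rule eq_matI)
    fix i j assume "i < dim_row ((2 / \<gamma>) \<cdot>\<^sub>m (mat_of_col w * ?r))" "j < dim_col ((2 / \<gamma>) \<cdot>\<^sub>m (mat_of_col w * ?r))"
    then have i: "i < n" and j: "j < m" using w r by (simp_all add: mat_of_col_def)
    have "\<gamma> * (?At *\<^sub>v r) $ i = (r \<bullet> r) * w $ i"
      using arg_cong[OF normal, of "\<lambda>u. u $ i"] At w i by simp
    then have quot: "(?At *\<^sub>v r) $ i / (r \<bullet> r) = w $ i / \<gamma>" using \<gamma> r0 by (simp add: field_simps)
    have left: "(?At * ?c * ?r) $$ (i, j) = (?At *\<^sub>v r) $ i * r $ j"
      using i j At r by (simp add: scalar_prod_def mat_of_col_def mat_of_row_def)
    have right: "(mat_of_col w * ?r) $$ (i, j) = w $ i * r $ j"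
      using i j w r by (simp add: scalar_prod_def mat_of_col_def mat_of_row_def)
    have "((2 / (r \<bullet> r)) \<cdot>\<^sub>m ((?At * ?c) * ?r)) $$ (i, j) = 2 * ((?At *\<^sub>v r) $ i / (r \<bullet> r)) * r $ j"
      using i j At r left by (simp del: index_mult_mat(1))
    also have "\<dots> = 2 * (w $ i / \<gamma>) * r $ j" by (simp only: quot)
    also have "\<dots> = ((2 / \<gamma>) \<cdot>\<^sub>m (mat_of_col w * ?r)) $$ (i, j)"
      using i j w r right by (simp add: mat_of_col_def del: index_mult_mat(1))
    finally show "((2 / (r \<bullet> r)) \<cdot>\<^sub>m ((?At * ?c) * ?r)) $$ (i, j)
        = ((2 / \<gamma>) \<cdot>\<^sub>m (mat_of_col w * ?r)) $$ (i, j)" .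
  qed (use w r A in \<open>simp_all add: mat_of_col_def\<close>)
  finally show ?thesis .
qed

section \<open>Eigenvalues of Gram matrices\<close>

text \<open>The usual argument: \<open>a v\<^sup>* v = v\<^sup>* S v\<close> is its own conjugate.\<close>

lemma symmetric_mat_eigenvalue_real:
  fixes S :: "real mat" and a :: complex
  assumes S: "S \<in> carrier_mat n n" and sym: "transpose_mat S = S"
    and a: "poly (char_poly (map_mat of_real S)) a = 0"
  shows "a \<in> \<real>"
proof -
  let ?S = "map_mat of_real S :: complex mat"
  have S': "?S \<in> carrier_mat n n" using S by simp
  have sym': "transpose_mat ?S = ?S" using sym by (metis map_mat_transpose)
  obtain v where v: "v \<in> carrier_vec n" and v0: "v \<noteq> 0\<^sub>v n" and Sv: "?S *\<^sub>v v = a \<cdot>\<^sub>v v"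
    using a eigenvalue_root_char_poly[OF S'] S' unfolding eigenvalue_def eigenvector_def by auto
  have cSv: "?S *\<^sub>v conjugate v = conjugate (?S *\<^sub>v v)"
    using S v by (intro eq_vecI) (simp_all add: scalar_prod_def)
  have "a * (v \<bullet> conjugate v) = (?S *\<^sub>v v) \<bullet> conjugate v" using v by (simp add: Sv)
  also have "\<dots> = v \<bullet> (?S *\<^sub>v conjugate v)"
    using transpose_vec_mult_scalar[OF S', of "conjugate v" v] v by (simp add: sym')
  also have "\<dots> = cnj a * (v \<bullet> conjugate v)"
    using v by (simp add: cSv Sv conjugate_smult_vec)
  finally have "a = cnj a" using v v0 by simp
  then show ?thesis by (metis Reals_cnj_iff)
qed

text \<open>Over the complex numbers the characteristic polynomial splits; as all its roots are real,
  the same linear factors split it over the reals. A list of real roots of full length is what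
  gives the \<open>i\<close>-th largest eigenvalue a meaning.\<close>

lemma symmetric_mat_size_proots_char_poly:
  fixes S :: "real mat"
  assumes S: "S \<in> carrier_mat n n" and sym: "transpose_mat S = S"
  shows "size (proots (char_poly S)) = n"
proof -
  let ?h = "of_real :: real \<Rightarrow> complex"
  interpret h: map_poly_inj_idom_hom ?h ..
  obtain as where as: "char_poly (map_mat ?h S) = (\<Prod>a\<leftarrow>as. [:- a, 1:])" and len: "length as = n"
    using char_poly_factorized[of "map_mat ?h S" n] S by auto
  define bs where "bs = map Re as"
  have "a \<in> \<real>" if "a \<in> set as" for a
  proof (rule symmetric_mat_eigenvalue_real[OF S sym])
    have "poly (\<Prod>a\<leftarrow>as. [:- a, 1:]) a = 0"
      using that by (simp add: poly_prod_list o_def prod_list_zero_iff image_iff)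
    then show "poly (char_poly (map_mat ?h S)) a = 0" by (simp add: as)
  qed
  then have as_bs: "as = map ?h bs"
    unfolding bs_def map_map by (intro map_idI[symmetric]) (simp add: complex_is_Real_iff complex_eq_iff)
  have "map_poly ?h (char_poly S) = (\<Prod>a\<leftarrow>map ?h bs. [:- a, 1:])"
    using as S by (simp add: of_real_hom.char_poly_hom[OF S, symmetric] as_bs)
  also have "\<dots> = map_poly ?h (\<Prod>b\<leftarrow>bs. [:- b, 1:])"
    by (induction bs) (simp_all add: h.hom_mult del: mult_pCons_left)
  finally have "char_poly S = (\<Prod>b\<leftarrow>bs. [:- b, 1:])"
    by simp
  also have "proots \<dots> = mset bs"
    by (induction bs) (simp_all add: proots_mult prod_list_zero_iff image_iff del: mult_pCons_left)
  finally show ?thesis using len by (simp add: bs_def)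
qed

lemma length_roots_desc_gram:
  fixes M :: "real mat"
  assumes "M \<in> carrier_mat p k"
  shows "length (roots_desc (char_poly (transpose_mat M * M))) = k"
proof -
  have "transpose_mat (transpose_mat M * M) = transpose_mat M * M"
    using assms by (simp add: transpose_mult[of _ k p])
  then show ?thesis
    using symmetric_mat_size_proots_char_poly[of "transpose_mat M * M" k] assms
    by (simp add: roots_desc_def flip: size_mset)
qed

lemma gram_root_nonneg:
  fixes M :: "real mat"
  assumes M: "M \<in> carrier_mat p k" and root: "poly (char_poly (transpose_mat M * M)) t = 0"
  shows "0 \<le> t"
proof -
  have MM: "transpose_mat M * M \<in> carrier_mat k k" using M by simp
  obtain v where v: "v \<in> carrier_vec k" and v0: "v \<noteq> 0\<^sub>v k"
    and Mv: "(transpose_mat M * M) *\<^sub>v v = t \<cdot>\<^sub>v v"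
    using root eigenvalue_root_char_poly[OF MM, of t] carrier_matD(1)[OF MM]
    unfolding eigenvalue_def eigenvector_def by metis
  have "t * (v \<bullet> v) = ((transpose_mat M * M) *\<^sub>v v) \<bullet> v" using v by (simp add: Mv)
  also have "\<dots> = (M *\<^sub>v v) \<bullet> (M *\<^sub>v v)"
    using M v transpose_vec_mult_scalar[OF M v, of "M *\<^sub>v v"] by simp
  also have "\<dots> \<ge> 0" using conjugate_square_ge_0_vec[of "M *\<^sub>v v"] by simp
  finally have "0 \<le> t * (v \<bullet> v)" .
  moreover have "0 < v \<bullet> v" using conjugate_square_greater_0_vec[OF v] v0 by simp
  ultimately show ?thesis by (simp add: zero_le_mult_iff)
qed

text \<open>The last entry of the decreasing list is the smallest root.\<close>

lemma not_root_below_roots_desc: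
  assumes p: "p \<noteq> 0" and t: "t < roots_desc p ! (length (roots_desc p) - 1)"
  shows "poly p t \<noteq> 0"
proof
  assume "poly p t = 0"
  then have "t \<in> set (roots_desc p)" using p by (simp add: roots_desc_def)
  then obtain i where i: "i < length (roots_desc p)" "t = roots_desc p ! i"
    by (auto simp: in_set_conv_nth)
  have "sorted_wrt (\<ge>) (roots_desc p)"
    by (simp add: roots_desc_def sorted_wrt_rev)
  then have "roots_desc p ! (length (roots_desc p) - 1) \<le> roots_desc p ! i"
    using i by (cases "i = length (roots_desc p) - 1") (auto simp: sorted_wrt_iff_nth_less)
  then show False using t i by simp
qed

lemma det_minus_smult_one:
  fixes M :: "real mat"
  assumes M: "M \<in> carrier_mat k k"
  shows "det (M - t \<cdot>\<^sub>m 1\<^sub>m k) = (-1) ^ k * poly (char_poly M) t"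
proof -
  have eq: "M - t \<cdot>\<^sub>m 1\<^sub>m k = (-1) \<cdot>\<^sub>m (- char_matrix M t)"
    using M by (intro eq_matI) (auto simp: char_matrix_def)
  have "- char_matrix M t \<in> carrier_mat k k" using M by simp
  then show ?thesis unfolding eq det_smult char_poly_matrix[OF M]
    by simp
qed

section \<open>The pencil of a block triangular factor\<close>

lemma poly_pencil_poly:
  assumes M: "M \<in> carrier_mat n n" and N: "N \<in> carrier_mat n n"
  shows "poly (pencil_poly M N) t = det (M - t \<cdot>\<^sub>m N)"
  unfolding pencil_poly_def by (rule poly_det_cong[of _ n]) (use M N in auto)

text \<open>Elimination of the block that belongs to the exactly known columns: the shifted Gram matrix
  factors as
  \<open>[R\<^sup>T, 0; X\<^sup>T, 1] [R, X; 0, Y\<^sup>T Y - t 1]\<close>, since the shift only touches the lower block.\<close>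

lemma det_block_gram_minus:
  fixes R X Y :: "real mat"
  assumes R: "R \<in> carrier_mat n1 n1" and X: "X \<in> carrier_mat n1 k" and Y: "Y \<in> carrier_mat p k"
  defines "S \<equiv> four_block_mat R X (0\<^sub>m p n1) Y"
    and "W \<equiv> four_block_mat (0\<^sub>m n1 n1) (0\<^sub>m n1 k) (0\<^sub>m k n1) (1\<^sub>m k)"
  shows "det (transpose_mat S * S - t \<cdot>\<^sub>m W)
    = (det R)\<^sup>2 * det (transpose_mat Y * Y - t \<cdot>\<^sub>m 1\<^sub>m k)"
proof -
  let ?T = "transpose_mat Y * Y - t \<cdot>\<^sub>m 1\<^sub>m k"
  let ?L = "four_block_mat (transpose_mat R) (0\<^sub>m n1 k) (transpose_mat X) (1\<^sub>m k)"
  let ?U = "four_block_mat R X (0\<^sub>m k n1) ?T"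
  have T: "?T \<in> carrier_mat k k" using Y by auto
  have Rt: "transpose_mat R \<in> carrier_mat n1 n1" and Xt: "transpose_mat X \<in> carrier_mat k n1"
    and Yt: "transpose_mat Y \<in> carrier_mat k p"
    using R X Y by simp_all
  have St: "transpose_mat S = four_block_mat (transpose_mat R) (0\<^sub>m n1 p) (transpose_mat X) (transpose_mat Y)"
    unfolding S_def using transpose_four_block_mat[OF R X zero_carrier_mat Y] by simp
  have SS: "transpose_mat S * S = four_block_mat (transpose_mat R * R) (transpose_mat R * X)
      (transpose_mat X * R) (transpose_mat X * X + transpose_mat Y * Y)"
    unfolding St unfolding S_def using R X Y
    by (subst mult_four_block_mat[OF Rt zero_carrier_mat Xt Yt R X zero_carrier_mat Y]) auto
  have "?L * ?U = four_block_mat (transpose_mat R * R) (transpose_mat R * X)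
      (transpose_mat X * R) (transpose_mat X * X + ?T)"
    using R X Y
    by (subst mult_four_block_mat[OF Rt zero_carrier_mat Xt one_carrier_mat R X zero_carrier_mat T])
      (auto intro!: arg_cong2[where f = "four_block_mat _ _"] simp: left_mult_one_mat[OF T])
  also have "\<dots> = transpose_mat S * S - t \<cdot>\<^sub>m W"
    unfolding SS W_def using R X Y by (intro eq_matI) auto
  finally have "det (transpose_mat S * S - t \<cdot>\<^sub>m W) = det ?L * det ?U"
    using det_mult[of ?L "n1 + k" ?U] R T by (metis four_block_carrier_mat one_carrier_mat Rt)
  also have "det ?L = det R"
    using det_four_block_mat_upper_right_zero[OF Rt refl Xt one_carrier_mat] det_transpose[OF R] by simp
  also have "det ?U = det R * det ?T"
    by (rule det_four_block_mat_lower_left_zero[OF R X refl T])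
  finally show ?thesis by (simp add: power2_eq_square)
qed

text \<open>By the determinant identity, the pencil has the characteristic polynomial of \<open>Y\<^sup>T Y\<close> up to
  a nonzero factor. Its degree falls short of the size by \<open>n1\<close>, so \<open>n1\<close> infinite eigenvalues come
  first and the last generalized eigenvalue is the smallest eigenvalue of \<open>Y\<^sup>T Y\<close>. For \<open>k = 0\<close> there
  would only be infinite ones.\<close>

lemma gen_eigenvalue_block_gram:
  fixes R X Y :: "real mat"
  assumes R: "R \<in> carrier_mat n1 n1" and X: "X \<in> carrier_mat n1 k" and Y: "Y \<in> carrier_mat p k"
    and detR: "det R \<noteq> 0" and k: "0 < k"
  defines "S \<equiv> four_block_mat R X (0\<^sub>m p n1) Y"
    and "W \<equiv> four_block_mat (0\<^sub>m n1 n1) (0\<^sub>m n1 k) (0\<^sub>m k n1) (1\<^sub>m k)"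
  shows "gen_eigenvalue (n1 + k) (transpose_mat S * S) W
    = ereal (roots_desc (char_poly (transpose_mat Y * Y)) ! (k - 1))"
proof -
  let ?p = "char_poly (transpose_mat Y * Y)" and ?c = "(det R)\<^sup>2 * (-1) ^ k"
  have YY: "transpose_mat Y * Y \<in> carrier_mat k k" using Y by simp
  have SS: "transpose_mat S * S \<in> carrier_mat (n1 + k) (n1 + k)"
    unfolding S_def by (intro mult_carrier_mat[of _ _ "n1 + p"]) (use R Y in simp_all)
  have W: "W \<in> carrier_mat (n1 + k) (n1 + k)" by (simp add: W_def)
  have "poly (pencil_poly (transpose_mat S * S) W) t = poly (smult ?c ?p) t" for t
    by (simp add: poly_pencil_poly[OF SS W] det_minus_smult_one[OF YY]
        det_block_gram_minus[OF R X Y, folded S_def W_def])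
  then have pencil: "pencil_poly (transpose_mat S * S) W = smult ?c ?p"
    by (simp add: poly_eq_poly_eq_iff[symmetric] fun_eq_iff)
  have c: "?c \<noteq> 0" using detR by simp
  have "roots_desc (smult ?c ?p) = roots_desc ?p"
    unfolding roots_desc_def proots_smult[OF c] ..
  moreover have "degree (smult ?c ?p) = k"
    using degree_monic_char_poly[OF YY] c by simp
  moreover have "dim_row (transpose_mat S * S) = n1 + k" using SS by blast
  ultimately show ?thesis
    unfolding gen_eigenvalue_def pencil using k length_roots_desc_gram[OF Y]
    by (simp add: nth_append)
qed

section \<open>Invertibility of the normal matrix\<close>

text \<open>The rank is the dimension of the span of the set of columns, in which equal columns
  collapse; they are excluded first, since then fewer than \<open>n\<close> vectors would span the column
  space.\<close>

lemma full_column_rank_imp_trivial_kernel: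
  fixes A :: "'a :: field mat"
  assumes A: "A \<in> carrier_mat m n" and rank: "vec_space.rank m A = n"
    and v: "v \<in> carrier_vec n" and Av: "A *\<^sub>v v = 0\<^sub>v m"
  shows "v = 0\<^sub>v n"
proof (rule ccontr)
  assume v0: "v \<noteq> 0\<^sub>v n"
  interpret V: vec_space "TYPE('a)" m .
  have dist: "distinct (cols A)"
  proof (rule ccontr)
    assume "\<not> distinct (cols A)"
    then have "card (set (cols A)) < n"
      using A card_distinct card_length cols_length by (metis carrier_matD(2) nat_less_le)
    moreover obtain S where S: "maximal S (\<lambda>T. T \<subseteq> set (cols A) \<and> V.lin_indpt T)"
      using maximal_exists_superset[of "set (cols A)" "\<lambda>T. T \<subseteq> set (cols A) \<and> V.lin_indpt T" "{}"]
        V.lin_dep_crit by (metis (no_types, lifting) List.finite_set V.finite_lin_indpt2 empty_iff empty_subsetI finite.emptyI)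
    then have "card S \<le> card (set (cols A))" by (simp add: card_mono maximal_def)
    ultimately show False using V.rank_card_indpt[OF A S] rank by simp
  qed
  show False
    using V.full_rank_lin_indpt[OF A rank dist] V.lin_depI[OF A v v0 Av dist] by blast
qed

lemma gram_orthogonal_mult:
  assumes Q: "real_orthogonal_mat m Q" and M: "M \<in> carrier_mat m k"
  shows "transpose_mat (transpose_mat Q * M) * (transpose_mat Q * M) = transpose_mat M * M"
proof -
  have Qc: "Q \<in> carrier_mat m m" and QQ: "Q * transpose_mat Q = 1\<^sub>m m"
    using Q by (simp_all add: real_orthogonal_mat_def)
  have "transpose_mat (transpose_mat Q * M) * (transpose_mat Q * M)
      = (transpose_mat M * Q) * (transpose_mat Q * M)"
    using Qc M by (simp add: transpose_mult[of _ m m])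
  also have "\<dots> = transpose_mat M * ((Q * transpose_mat Q) * M)"
    using Qc M by (simp add: assoc_mult_mat[of _ k m _ m _ k] assoc_mult_mat[of _ m m _ m _ k])
  finally show ?thesis using M by (simp add: QQ)
qed

text \<open>A kernel vector of \<open>R\<close>, padded with zeros, would be a kernel vector of \<open>A\<close>.\<close>

lemma full_column_rank_imp_det_R_nonzero:
  fixes A :: "real mat"
  assumes A: "A \<in> carrier_mat m (n1 + n2)" and rank: "vec_space.rank m A = n1 + n2"
    and Q: "real_orthogonal_mat m Q"
    and R: "R \<in> carrier_mat n1 n1" and X: "X \<in> carrier_mat n1 n2" and Y: "Y \<in> carrier_mat p n2"
    and QA: "transpose_mat Q * A = four_block_mat R X (0\<^sub>m p n1) Y"
  shows "det R \<noteq> 0"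
proof
  assume "det R = 0"
  then obtain v where v: "v \<in> carrier_vec n1" "v \<noteq> 0\<^sub>v n1" and Rv: "R *\<^sub>v v = 0\<^sub>v n1"
    using det_0_iff_vec_prod_zero_field[OF R] by blast
  let ?w = "v @\<^sub>v 0\<^sub>v n2"
  have w: "?w \<in> carrier_vec (n1 + n2)" using v by simp
  have Qc: "Q \<in> carrier_mat m m" and QQ: "Q * transpose_mat Q = 1\<^sub>m m"
    using Q by (simp_all add: real_orthogonal_mat_def)
  have "n1 + p = m" using arg_cong[OF QA, of dim_row] Qc R Y by simp
  have zero: "M *\<^sub>v 0\<^sub>v k = 0\<^sub>v q" if "M \<in> carrier_mat q k" for M :: "real mat" and q k
    using that by (intro eq_vecI) (auto simp: scalar_prod_def)
  have "transpose_mat Q *\<^sub>v (A *\<^sub>v ?w) = (transpose_mat Q * A) *\<^sub>v ?w"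
    using Qc A w by simp
  also have "\<dots> = 0\<^sub>v (n1 + p)"
    unfolding QA using v X Y
    by (subst four_block_mat_mult_vec[OF R X zero_carrier_mat Y])
      (auto simp: Rv zero[OF X] zero[OF Y] intro!: eq_vecI)
  finally have "transpose_mat Q *\<^sub>v (A *\<^sub>v ?w) = 0\<^sub>v m" using \<open>n1 + p = m\<close> by simp
  then have "Q *\<^sub>v (transpose_mat Q *\<^sub>v (A *\<^sub>v ?w)) = 0\<^sub>v m" using zero[OF Qc] by simp
  moreover have "Q *\<^sub>v (transpose_mat Q *\<^sub>v (A *\<^sub>v ?w)) = (Q * transpose_mat Q) *\<^sub>v (A *\<^sub>v ?w)"
    using Qc A w by simp
  ultimately have "A *\<^sub>v ?w = 0\<^sub>v m" using QQ A w by simp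
  then have "?w = 0\<^sub>v (n1 + n2)"
    by (rule full_column_rank_imp_trivial_kernel[OF A rank w])
  then have "?w $ i = 0" if "i < n1" for i using that by simp
  then have "v $ i = 0" if "i < n1" for i using that v(1) by (metis carrier_vecD index_append_vec(1) trans_less_add1)
  then have "v = 0\<^sub>v n1" using v(1) by (intro eq_vecI) auto
  then show False using v(2) by simp
qed

text \<open>Under either genericity condition \<open>\<sigma>\<^sup>2\<close> lies strictly below all eigenvalues of \<open>Y\<^sup>T Y\<close>,
  hence is not one of them, and the block determinant is nonzero. For the second condition
  this uses that the last generalized eigenvalues of the two pencils are the squares of the
  singular values in the first one. Squaring back is then
  justified because the eigenvalues of \<open>Y'\<^sup>T Y'\<close> are nonnegative.\<close>

lemma generic_imp_det_normal_matrix_nonzero: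
  fixes R X Y X' Y' :: "real mat"
  assumes R: "R \<in> carrier_mat n1 n1" and detR: "det R \<noteq> 0"
    and X: "X \<in> carrier_mat n1 k" and Y: "Y \<in> carrier_mat p k"
    and X': "X' \<in> carrier_mat n1 (k + 1)" and Y': "Y' \<in> carrier_mat p (k + 1)"
  defines "S \<equiv> four_block_mat R X (0\<^sub>m p n1) Y"
    and "S' \<equiv> four_block_mat R X' (0\<^sub>m p n1) Y'"
    and "W \<equiv> four_block_mat (0\<^sub>m n1 n1) (0\<^sub>m n1 k) (0\<^sub>m k n1) (1\<^sub>m k)"
    and "W' \<equiv> four_block_mat (0\<^sub>m n1 n1) (0\<^sub>m n1 (k + 1)) (0\<^sub>m (k + 1) n1) (1\<^sub>m (k + 1))"
  assumes \<sigma>: "ereal \<sigma> = singular_value (k + 1) Y'"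
    and generic: "(singular_value k Y > singular_value (k + 1) Y' \<and> singular_value (k + 1) Y' > 0)
      \<or> gen_eigenvalue (n1 + k) (transpose_mat S * S) W
        > gen_eigenvalue (n1 + (k + 1)) (transpose_mat S' * S') W'"
  shows "det (transpose_mat S * S - \<sigma>\<^sup>2 \<cdot>\<^sub>m W) \<noteq> 0"
proof -
  let ?p = "char_poly (transpose_mat Y * Y)" and ?p' = "char_poly (transpose_mat Y' * Y')"
  let ?l = "roots_desc ?p ! (k - 1)" and ?l' = "roots_desc ?p' ! k"
  have YY: "transpose_mat Y * Y \<in> carrier_mat k k" using Y by simp
  have YY': "transpose_mat Y' * Y' \<in> carrier_mat (k + 1) (k + 1)" using Y' by simp
  have monic: "degree ?p = k" "lead_coeff ?p = 1" using degree_monic_char_poly[OF YY] by simp_all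
  have p0: "?p \<noteq> 0" and p0': "?p' \<noteq> 0"
    using degree_monic_char_poly[OF YY] degree_monic_char_poly[OF YY'] by auto
  have "poly ?p (\<sigma>\<^sup>2) \<noteq> 0"
  proof (cases "k = 0")
    case True
    then show ?thesis using monic by (auto elim: degree_eq_zeroE)
  next
    case False
    have \<sigma>': "\<sigma> = sqrt ?l'" using \<sigma> by (simp add: singular_value_def)
    have "\<sigma>\<^sup>2 < ?l"
      using generic
    proof
      assume "singular_value k Y > singular_value (k + 1) Y' \<and> singular_value (k + 1) Y' > 0"
      then have "\<sigma> < sqrt ?l" "0 < \<sigma>"
        using False by (simp_all add: \<sigma>' singular_value_def)
      moreover from this have "0 \<le> ?l" using real_sqrt_gt_0_iff[of ?l] by linarith
      ultimately show ?thesis using power_strict_mono[of \<sigma> "sqrt ?l" 2] by simp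
    next
      assume "gen_eigenvalue (n1 + k) (transpose_mat S * S) W
        > gen_eigenvalue (n1 + (k + 1)) (transpose_mat S' * S') W'"
      then have less: "?l' < ?l"
        using False gen_eigenvalue_block_gram[OF R X Y detR]
          gen_eigenvalue_block_gram[OF R X' Y' detR]
        by (simp add: S_def S'_def W_def W'_def)
      have "?l' \<in> set (roots_desc ?p')"
        using length_roots_desc_gram[OF Y'] by (intro nth_mem) simp
      then have "poly ?p' ?l' = 0" using p0' by (simp add: roots_desc_def)
      then have "0 \<le> ?l'" by (rule gram_root_nonneg[OF Y'])
      then show ?thesis using less by (simp add: \<sigma>')
    qed
    then show ?thesis
      using not_root_below_roots_desc[OF p0] by (simp add: length_roots_desc_gram[OF Y])
  qed
  then show ?thesis
    unfolding S_def W_def det_block_gram_minus[OF R X Y] det_minus_smult_one[OF YY]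
    using detR by simp
qed

text \<open>For a singular matrix \<^const>\<open>mat_inverse\<close> selects nothing and the value has an unspecified
  format; invertibility is what makes the products in both formulae well formed.\<close>

lemma mat_inverse_carrier:
  fixes P :: "'a :: field mat"
  assumes P: "P \<in> carrier_mat n n" and det: "det P \<noteq> 0"
  shows "the (mat_inverse P) \<in> carrier_mat n n"
  using mat_inverse(1)[OF P, of "()"] mat_inverse(2)[OF P] det_non_zero_imp_unit[OF P det, of "()"]
  by (cases "mat_inverse P") auto

section \<open>Equivalence of the two formulae\<close>

theorem theorem2:
  fixes m n n1 n2 :: nat
    and A1 A2 A At W Wt Q R11 R12 R1b R22 R2b P Pinv H0 G D :: "real mat"
    and b x r :: "real vec"
    and \<sigma> \<gamma> :: real
  assumes A1: "A1 \<in> carrier_mat m n1" and A2: "A2 \<in> carrier_mat m n2"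
    and n: "n = n1 + n2" and mn: "m \<ge> n"
    and A: "A = A1 @\<^sub>c A2"
    and full_rank: "vec_space.rank m A = n"
    and b: "b \<in> carrier_vec m"
    and inconsistent: "\<not> (\<exists>y \<in> carrier_vec n. A *\<^sub>v y = b)"
    and At: "At = A @\<^sub>c mat_of_col b"
    and W: "W = diag_block_mat [0\<^sub>m n1 n1, 1\<^sub>m n2]"
    and Wt: "Wt = diag_block_mat [W, 1\<^sub>m 1]"
    and Q: "real_orthogonal_mat m Q"
    and R11: "R11 \<in> carrier_mat n1 n1" and R12: "R12 \<in> carrier_mat n1 n2"
    and R1b: "R1b \<in> carrier_mat n1 1"
    and R22: "R22 \<in> carrier_mat (m - n1) n2" and R2b: "R2b \<in> carrier_mat (m - n1) 1"
    and QR: "transpose_mat Q * At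
          = four_block_mat R11 (R12 @\<^sub>c R1b) (0\<^sub>m (m - n1) n1) (R22 @\<^sub>c R2b)"
    and triangular: "upper_triangular_rect (transpose_mat Q * At)"
    and \<sigma>: "ereal \<sigma> = singular_value (n2 + 1) (R22 @\<^sub>c R2b)"
    and generic:
      "(singular_value n2 R22 > singular_value (n2 + 1) (R22 @\<^sub>c R2b) \<and>
          singular_value (n2 + 1) (R22 @\<^sub>c R2b) > 0)
       \<or> gen_eigenvalue n (transpose_mat A * A) W
           > gen_eigenvalue (n + 1) (transpose_mat At * At) Wt"
    and x: "is_MTLS_solution A1 A2 b x"
    and r: "r = A *\<^sub>v x - b"
    and P: "P = transpose_mat A * A - \<sigma>\<^sup>2 \<cdot>\<^sub>m W"
    and Pinv: "Pinv = the (mat_inverse P)"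
    and \<gamma>: "\<gamma> = 1 + x \<bullet> (W *\<^sub>v x)"
    and H0: "H0 = 1\<^sub>m m - (2 / (r \<bullet> r)) \<cdot>\<^sub>m (mat_of_col r * mat_of_row r)"
    and G: "G = mat_of_row (x @\<^sub>v vec_of_list [-1]) \<otimes>\<^sub>k 1\<^sub>m m"
    and D: "D = Pinv * (transpose_mat A
          - (2 / \<gamma>) \<cdot>\<^sub>m (mat_of_col (W *\<^sub>v x) * mat_of_row r))"
  shows "(- (mat_of_row x \<otimes>\<^sub>k D) - (mat_of_row r \<otimes>\<^sub>k Pinv) * vec_perm_mat m n) @\<^sub>c D
       = - (Pinv * (transpose_mat A * H0 * G
            + ((1\<^sub>m n \<otimes>\<^sub>k mat_of_row r) @\<^sub>c 0\<^sub>m n m)))"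
proof -
  have Ac: "A \<in> carrier_mat m n" unfolding A n by (rule append_cols_carrier[OF A1 A2])
  have W': "W = four_block_mat (0\<^sub>m n1 n1) (0\<^sub>m n1 n2) (0\<^sub>m n2 n1) (1\<^sub>m n2)"
    unfolding W diag_block_mat_pair by simp
  have Wc: "W \<in> carrier_mat n n" unfolding W' n by simp
  have Wt': "Wt = four_block_mat (0\<^sub>m n1 n1) (0\<^sub>m n1 (n2 + 1)) (0\<^sub>m (n2 + 1) n1) (1\<^sub>m (n2 + 1))"
    unfolding Wt diag_block_mat_pair W' by (intro eq_matI) auto
  have xc: "x \<in> carrier_vec n"
    unfolding n by (rule MTLS_solution_minimises_quotient(1)[OF A1 A2 b x zero_carrier_vec])
  have Wx: "W *\<^sub>v x \<in> carrier_vec n" using mult_mat_vec_carrier[OF Wc xc] .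
  have rc: "r \<in> carrier_vec m" unfolding r using mult_mat_vec_carrier[OF Ac xc] b by simp
  have normal: "\<gamma> \<cdot>\<^sub>v (transpose_mat A *\<^sub>v r) = (r \<bullet> r) \<cdot>\<^sub>v (W *\<^sub>v x)"
    unfolding \<gamma> r A W' by (rule MTLS_solution_normal_equations[OF A1 A2 b x])
  have "r \<noteq> 0\<^sub>v m"
  proof
    assume r0: "r = 0\<^sub>v m"
    have "A *\<^sub>v x = r + b" unfolding r using mult_mat_vec_carrier[OF Ac xc] Ac b by (intro eq_vecI) auto
    then show False using inconsistent xc b r0 by auto
  qed
  then have r0: "r \<bullet> r \<noteq> 0" using conjugate_square_eq_0_vec[OF rc] by simp
  have "0 < \<gamma>"
    unfolding \<gamma> W' quadratic_form_lower_identity[OF xc[unfolded n]]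
    using scalar_prod_self_nonneg[of "vec_last x n2"] by simp
  then have AH0: "transpose_mat A * H0 = transpose_mat A - (2 / \<gamma>) \<cdot>\<^sub>m (mat_of_col (W *\<^sub>v x) * mat_of_row r)"
    unfolding H0 using transpose_mult_reflector[OF Ac rc Wx normal _ r0] by simp

  have bc: "mat_of_col b \<in> carrier_mat m 1" by (rule mat_of_col_carrier[OF b])
  have Atc: "At \<in> carrier_mat m (n + 1)" unfolding At by (rule append_cols_carrier[OF Ac bc])
  have Qc: "Q \<in> carrier_mat m m" using Q by (simp add: real_orthogonal_mat_def)
  have m: "n1 + (m - n1) = m" using mn n by simp
  have QA: "transpose_mat Q * A = four_block_mat R11 R12 (0\<^sub>m (m - n1) n1) R22"
  proof (rule left_block_of_append_cols[OF _ _ R11 R12 R1b R22 R2b])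
    show "(transpose_mat Q * A) @\<^sub>c (transpose_mat Q * mat_of_col b)
        = four_block_mat R11 (R12 @\<^sub>c R1b) (0\<^sub>m (m - n1) n1) (R22 @\<^sub>c R2b)"
      unfolding QR[symmetric] At using Qc by (intro mult_append_cols[symmetric, OF _ Ac bc]) simp
  qed (use Qc Ac bc in \<open>simp_all only: m n[symmetric] transpose_carrier_mat mult_carrier_mat\<close>)
  have detR: "det R11 \<noteq> 0"
    by (rule full_column_rank_imp_det_R_nonzero[OF Ac[unfolded n] full_rank[unfolded n] Q R11 R12 R22 QA])
  \<comment> \<open>Orthogonal invariance turns both Gram matrices into those of the triangular factors.\<close>
  have "det P \<noteq> 0"
    unfolding P gram_orthogonal_mult[OF Q Ac, symmetric] QA W'
  proof (rule generic_imp_det_normal_matrix_nonzero[OF R11 detR R12 R22 _ _ \<sigma>])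
    show "R12 @\<^sub>c R1b \<in> carrier_mat n1 (n2 + 1)" by (rule append_cols_carrier[OF R12 R1b])
    show "R22 @\<^sub>c R2b \<in> carrier_mat (m - n1) (n2 + 1)" by (rule append_cols_carrier[OF R22 R2b])
  qed (use generic in \<open>simp only: gram_orthogonal_mult[OF Q Ac, symmetric]
      gram_orthogonal_mult[OF Q Atc, symmetric] QA QR W' Wt' n add.assoc\<close>)
  moreover have "P \<in> carrier_mat n n" unfolding P by (intro minus_carrier_mat smult_carrier_mat Wc)
  ultimately have Pc: "Pinv \<in> carrier_mat n n" unfolding Pinv by (intro mat_inverse_carrier)

  have B: "transpose_mat A * H0 \<in> carrier_mat n m"
    unfolding AH0 by (intro minus_carrier_mat smult_carrier_mat
        mult_carrier_mat[OF mat_of_col_carrier[OF Wx] mat_of_row_carrier(1)[OF rc]])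
  have "D = Pinv * (transpose_mat A * H0)" unfolding D AH0 ..
  then show ?thesis unfolding G by (rule perturbation_matrices_eq[OF Pc B xc rc])
qed

end
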